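(* Let $(P,\cdot,[-,-],\varepsilon,\alpha,\beta)$ be a BiHom-Poisson color algebra, let $k,l\geq 0$ be integers, and let $\theta:P\to P$ be an element of the $(\alpha^k,\beta^l)$-centroid of $P$. Then, with the multiplications $$x\ast y:=\alpha^k\beta^l(x)\cdot\theta(y)\quad\text{and}\quad\{x,y\}:=[\alpha^k\beta^l(x),\theta(y)],$$ $(P,\ast,\{-,-\},\varepsilon,\alpha^{k+1}\beta^l,\alpha^k\beta^{l+1})$ is a BiHom-Poisson color algebra.
   Context: $\mathbb{K}$ is a field of characteristic different from 2 and $G$ is an abelian group (written additively). A skew-symmetric bicharacter on $G$ is a map $\varepsilon:G\times G\to\mathbb{K}^*$ with $\varepsilon(g,g')\varepsilon(g',g)=1$, $\varepsilon(g,g'+g'')=\varepsilon(g,g')\varepsilon(g,g'')$, $\varepsilon(g+g',g'')=\varepsilon(g,g'')\varepsilon(g',g'')$; $\varepsilon$ denotes such a bicharacter. For homogeneous $x,y$ of degrees $g,g'$ one writes $\varepsilon(x,y)=\varepsilon(g,g')$. A linear map is even if it preserves degrees; a bilinear map $\mu$ is even if $\mu(V_g,V_{g'})\subseteq V_{g+g'}$. A BiHom-Poisson color algebra $(P,\cdot,[-,-],\varepsilon,\alpha,\beta)$ is a $G$-graded $\mathbb{K}$-vector space $P$ with an even bilinear product $\cdot$, an even bilinear bracket $[-,-]$, and even linear maps $\alpha,\beta:P\to P$ such that $\alpha\beta=\beta\alpha$, $\alpha$ and $\beta$ are multiplicative for both the product and the bracket, and for all homogeneous $x,y,z$: - $\alpha(x)\cdot(y\cdot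 z)=(x\cdot y)\cdot\beta(z)$; - $[\beta(x),\alpha(y)]=-\varepsilon(x,y)[\beta(y),\alpha(x)]$; - $\oint_{x,y,z}\varepsilon(z,x)[\beta^2(x),[\beta(y),\alpha(z)]]=0$ (cyclic sum over $x,y,z$); - $[\alpha\beta(x),y\cdot z]=[\beta(x),y]\cdot\beta(z)+\varepsilon(x,y)\,\beta(y)\cdot[\alpha(x),z]$. An element of the $(\alpha^k,\beta^l)$-centroid of $P$ is an even linear map $\theta:P\to P$ with $\alpha\theta=\theta\alpha$, $\beta\theta=\theta\beta$, $\theta(x)\cdot\alpha^k\beta^l(y)=\theta(x)\cdot\theta(y)=\alpha^k\beta^l(x)\cdot\theta(y)$ and $[\theta(x),\alpha^k\beta^l(y)]=[\theta(x),\theta(y)]=[\alpha^k\beta^l(x),\theta(y)]$ for all homogeneous $x,y\in P$. *)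

theory Defs
  imports Complex_Main
begin

locale skew_symmetric_bicharacter =
  fixes \<epsilon> :: "'g::ab_group_add \<Rightarrow> 'g \<Rightarrow> 'k::field"
  assumes nonzero: "\<epsilon> g h \<noteq> 0"
    and skew: "\<epsilon> g h * \<epsilon> h g = 1"
    and add_right: "\<epsilon> g (h + h') = \<epsilon> g h * \<epsilon> g h'"
    and add_left: "\<epsilon> (g + h) g' = \<epsilon> g g' * \<epsilon> h g'"

text \<open>
  The family V is a grading when the vector space is the internal direct sum of the subspaces V g:
  every vector has exactly one decomposition into homogeneous components, almost all zero.
\<close>

locale graded_vector_space = vector_space scale
  for scale :: "'k::field \<Rightarrow> 'p::ab_group_add \<Rightarrow> 'p"
    and V :: "'g::ab_group_add \<Rightarrow> 'p set" +
  assumes subspace_component: "subspace (V g)"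
    and direct_sum:
      "\<exists>!c. (\<forall>g. c g \<in> V g) \<and> finite {g. c g \<noteq> 0} \<and> (\<Sum>g | c g \<noteq> 0. c g) = x"
begin

definition even_linear :: "('p \<Rightarrow> 'p) \<Rightarrow> bool" where
  "even_linear f \<longleftrightarrow> Vector_Spaces.linear scale scale f \<and> (\<forall>g. \<forall>x\<in>V g. f x \<in> V g)"

definition even_bilinear :: "('p \<Rightarrow> 'p \<Rightarrow> 'p) \<Rightarrow> bool" where
  "even_bilinear \<mu> \<longleftrightarrow>
    (\<forall>x. Vector_Spaces.linear scale scale (\<lambda>y. \<mu> x y)) \<and>
    (\<forall>y. Vector_Spaces.linear scale scale (\<lambda>x. \<mu> x y)) \<and>
    (\<forall>g h. \<forall>x\<in>V g. \<forall>y\<in>V h. \<mu> x y \<in> V (g + h))"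

end

text \<open>
  The degrees of homogeneous elements are quantified explicitly instead of being read off from the
  elements, since 0 lies in every V g.
\<close>

locale bihom_poisson_color_algebra =
  graded_vector_space scale V + skew_symmetric_bicharacter \<epsilon>
  for scale :: "'k::field \<Rightarrow> 'p::ab_group_add \<Rightarrow> 'p"
    and V :: "'g::ab_group_add \<Rightarrow> 'p set"
    and \<epsilon> :: "'g \<Rightarrow> 'g \<Rightarrow> 'k" +
  fixes prd :: "'p \<Rightarrow> 'p \<Rightarrow> 'p"
    and brk :: "'p \<Rightarrow> 'p \<Rightarrow> 'p"
    and \<alpha> :: "'p \<Rightarrow> 'p"
    and \<beta> :: "'p \<Rightarrow> 'p"
  assumes even_prd: "even_bilinear prd"
    and even_brk: "even_bilinear brk"
    and even_alpha: "even_linear \<alpha>"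
    and even_beta: "even_linear \<beta>"
    and alpha_beta_commute: "\<alpha> \<circ> \<beta> = \<beta> \<circ> \<alpha>"
    and alpha_prd: "\<alpha> (prd x y) = prd (\<alpha> x) (\<alpha> y)"
    and beta_prd: "\<beta> (prd x y) = prd (\<beta> x) (\<beta> y)"
    and alpha_brk: "\<alpha> (brk x y) = brk (\<alpha> x) (\<alpha> y)"
    and beta_brk: "\<beta> (brk x y) = brk (\<beta> x) (\<beta> y)"
    and bihom_associative:
      "\<lbrakk>x \<in> V a; y \<in> V b; z \<in> V c\<rbrakk> \<Longrightarrow> prd (\<alpha> x) (prd y z) = prd (prd x y) (\<beta> z)"
    and bihom_skew_symmetric:
      "\<lbrakk>x \<in> V a; y \<in> V b\<rbrakk> \<Longrightarrow>
        brk (\<beta> x) (\<alpha> y) = - scale (\<epsilon> a b) (brk (\<beta> y) (\<alpha> x))"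
    and bihom_jacobi:
      "\<lbrakk>x \<in> V a; y \<in> V b; z \<in> V c\<rbrakk> \<Longrightarrow>
        scale (\<epsilon> c a) (brk (\<beta> (\<beta> x)) (brk (\<beta> y) (\<alpha> z)))
        + scale (\<epsilon> a b) (brk (\<beta> (\<beta> y)) (brk (\<beta> z) (\<alpha> x)))
        + scale (\<epsilon> b c) (brk (\<beta> (\<beta> z)) (brk (\<beta> x) (\<alpha> y))) = 0"
    and bihom_leibniz:
      "\<lbrakk>x \<in> V a; y \<in> V b; z \<in> V c\<rbrakk> \<Longrightarrow>
        brk (\<alpha> (\<beta> x)) (prd y z)
          = prd (brk (\<beta> x) y) (\<beta> z) + scale (\<epsilon> a b) (prd (\<beta> y) (brk (\<alpha> x) z))"
begin

definition centroid :: "nat \<Rightarrow> nat \<Rightarrow> ('p \<Rightarrow> 'p) set" where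
  "centroid k l = {\<theta>. even_linear \<theta> \<and> \<alpha> \<circ> \<theta> = \<theta> \<circ> \<alpha> \<and> \<beta> \<circ> \<theta> = \<theta> \<circ> \<beta> \<and>
    (\<forall>g h. \<forall>x\<in>V g. \<forall>y\<in>V h.
      prd (\<theta> x) ((\<alpha> ^^ k) ((\<beta> ^^ l) y)) = prd (\<theta> x) (\<theta> y) \<and>
      prd (\<theta> x) (\<theta> y) = prd ((\<alpha> ^^ k) ((\<beta> ^^ l) x)) (\<theta> y) \<and>
      brk (\<theta> x) ((\<alpha> ^^ k) ((\<beta> ^^ l) y)) = brk (\<theta> x) (\<theta> y) \<and>
      brk (\<theta> x) (\<theta> y) = brk ((\<alpha> ^^ k) ((\<beta> ^^ l) x)) (\<theta> y))}"

end

end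

theory Submission
  imports Defs
begin

text \<open>
  Put \<open>\<gamma> = \<alpha>\<^sup>k \<beta>\<^sup>l\<close>.  This map is even, multiplicative for both operations and commutes with
  \<open>\<alpha>\<close>, \<open>\<beta>\<close> and \<open>\<theta>\<close>, and the new twisting maps are \<open>\<alpha>\<gamma>\<close> and \<open>\<beta>\<gamma>\<close>.  The centroid relations say that on homogeneous elements an occurrence of
  \<open>\<gamma>\<close> in one factor may be traded for \<open>\<theta>\<close> as long as the other factor carries \<open>\<theta>\<close>.  Hence
  both new operations are the old ones evaluated on \<open>\<theta>\<close>-images, say \<open>x \<ast> y = \<theta>x \<cdot> \<theta>y\<close>.

  The axioms involve nested operations, where \<open>\<theta>\<close> would have to act on a product, and nothing
  relates \<open>\<theta>(x \<cdot> y)\<close> to \<open>x\<close> and \<open>y\<close>.  The way out is to trade that outer \<open>\<theta>\<close> back for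
  \<open>\<gamma>\<close>, which is multiplicative: \<open>x \<ast> (y \<ast> z) = \<theta>x \<cdot> \<gamma>(\<theta>y \<cdot> \<theta>z) = \<theta>x \<cdot> (\<theta>\<gamma>y \<cdot> \<theta>\<gamma>z)\<close>.
  After this rewriting (lemmas \<open>twisted_outer_left\<close> and \<open>twisted_outer_right\<close>) each axiom
  becomes the old axiom at the images of \<open>x\<close>, \<open>y\<close>, \<open>z\<close> under \<open>\<theta>\<gamma>\<close> or \<open>\<theta>\<gamma>\<^sup>2\<close>, which have
  the same degrees and so the same signs \<open>\<epsilon>\<close>.  The inner operation is put in the form with
  \<open>\<theta>\<close> on both arguments because, with the mixed form \<open>\<gamma>y \<cdot> \<theta>z\<close>, the Leibniz identity
  produces the term \<open>\<beta>\<gamma>\<^sup>2y \<cdot> [\<alpha>\<theta>\<gamma>\<^sup>2x, \<theta>\<gamma>z]\<close>, in which \<open>\<gamma>\<^sup>2y\<close> should become \<open>\<theta>\<gamma>y\<close> but the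
  other factor is not visibly a \<open>\<theta>\<close>-image.
\<close>

context graded_vector_space
begin

lemma even_linear_mem: "even_linear f \<Longrightarrow> x \<in> V g \<Longrightarrow> f x \<in> V g"
  by (auto simp: even_linear_def)

lemma even_linear_compose:
  assumes "even_linear f" "even_linear h"
  shows "even_linear (f \<circ> h)"
  using assms by (auto simp: even_linear_def intro: Vector_Spaces.linear_compose)

lemma even_linear_funpow:
  assumes "even_linear f"
  shows "even_linear (f ^^ n)"
proof (induction n)
  case 0
  show ?case by (simp add: even_linear_def id_def linear_ident)
next
  case (Suc n)
  show ?case unfolding funpow.simps by (rule even_linear_compose[OF assms Suc.IH])
qed

lemma even_bilinear_compose:
  assumes "even_bilinear \<mu>" "even_linear f" "even_linear h"
  shows "even_bilinear (\<lambda>x y. \<mu> (f x) (h y))"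
proof -
  have "Vector_Spaces.linear scale scale (\<lambda>y. \<mu> (f x) (h y))" for x
    using assms Vector_Spaces.linear_compose[of scale scale h scale "\<mu> (f x)"]
    by (simp add: even_bilinear_def even_linear_def o_def)
  moreover have "Vector_Spaces.linear scale scale (\<lambda>x. \<mu> (f x) (h y))" for y
    using assms Vector_Spaces.linear_compose[of scale scale f scale "\<lambda>x. \<mu> x (h y)"]
    by (simp add: even_bilinear_def even_linear_def o_def)
  ultimately show ?thesis
    using assms by (simp add: even_bilinear_def even_linear_def)
qed

lemma even_bilinear_mem:
  "even_bilinear \<mu> \<Longrightarrow> x \<in> V g \<Longrightarrow> y \<in> V h \<Longrightarrow> \<mu> x y \<in> V (g + h)"
  by (auto simp: even_bilinear_def)

text \<open>
  The outer operation \<open>\<mu>\<close> and the inner operation \<open>\<nu>\<close> are kept apart because they differ in the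
  Leibniz identity.  In both lemmas the inner value is first rewritten as \<open>\<nu> (\<theta> \<dots>) (\<theta> \<dots>)\<close> and then
  hit by the multiplicative \<open>\<gamma>\<close>; when it is the right argument of \<open>\<mu>\<close>, where \<open>\<theta>\<close> stands, this
  needs the trade in \<open>\<mu>\<close>, for which the inner value has to be homogeneous.
\<close>

lemma twisted_outer_right:
  assumes trade_\<mu>: "\<And>g h x y. x \<in> V g \<Longrightarrow> y \<in> V h \<Longrightarrow>
      \<mu> (\<theta> x) (\<gamma> y) = \<mu> (\<theta> x) (\<theta> y) \<and> \<mu> (\<gamma> x) (\<theta> y) = \<mu> (\<theta> x) (\<theta> y)"
    and trade_\<nu>: "\<And>g h x y. x \<in> V g \<Longrightarrow> y \<in> V h \<Longrightarrow> \<nu> (\<gamma> x) (\<theta> y) = \<nu> (\<theta> x) (\<theta> y)"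
    and even: "even_bilinear \<nu>" "even_linear \<theta>"
    and mult: "\<And>x y. \<gamma> (\<nu> x y) = \<nu> (\<gamma> x) (\<gamma> y)"
    and xyz: "x \<in> V a" "y \<in> V b" "z \<in> V c"
  shows "\<mu> (\<gamma> x) (\<theta> (\<nu> (\<gamma> y) (\<theta> z))) = \<mu> (\<theta> x) (\<nu> (\<gamma> (\<theta> y)) (\<gamma> (\<theta> z)))"
proof -
  have "\<nu> (\<theta> y) (\<theta> z) \<in> V (b + c)"
    by (rule even_bilinear_mem[OF even(1)
        even_linear_mem[OF even(2) xyz(2)] even_linear_mem[OF even(2) xyz(3)]])
  from trade_\<mu>[OF xyz(1) this] show ?thesis
    by (simp add: trade_\<nu>[OF xyz(2,3)] mult)
qed

lemma twisted_outer_left: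
  assumes trade_\<nu>: "\<And>g h x y. x \<in> V g \<Longrightarrow> y \<in> V h \<Longrightarrow> \<nu> (\<gamma> x) (\<theta> y) = \<nu> (\<theta> x) (\<theta> y)"
    and mult: "\<And>x y. \<gamma> (\<nu> x y) = \<nu> (\<gamma> x) (\<gamma> y)"
    and xy: "x \<in> V a" "y \<in> V b"
  shows "\<mu> (\<gamma> (\<nu> (\<gamma> x) (\<theta> y))) (\<theta> z) = \<mu> (\<nu> (\<gamma> (\<theta> x)) (\<gamma> (\<theta> y))) (\<theta> z)"
  by (simp add: trade_\<nu>[OF xy] mult)

end

text \<open>
  Any even endomorphism \<open>\<gamma>\<close> commuting with the structure maps can play the part of
  \<open>\<alpha>\<^sup>k \<beta>\<^sup>l\<close>.
\<close>

theorem (in bihom_poisson_color_algebra) centroid_twist: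
  assumes even: "even_linear \<gamma>" "even_linear \<theta>"
    and commute_\<gamma>: "\<And>x. \<gamma> (\<alpha> x) = \<alpha> (\<gamma> x)" "\<And>x. \<gamma> (\<beta> x) = \<beta> (\<gamma> x)"
    and commute_\<theta>: "\<And>x. \<theta> (\<alpha> x) = \<alpha> (\<theta> x)" "\<And>x. \<theta> (\<beta> x) = \<beta> (\<theta> x)"
      "\<And>x. \<theta> (\<gamma> x) = \<gamma> (\<theta> x)"
    and mult_\<gamma>: "\<And>x y. \<gamma> (prd x y) = prd (\<gamma> x) (\<gamma> y)"
      "\<And>x y. \<gamma> (brk x y) = brk (\<gamma> x) (\<gamma> y)"
    and trade_prd: "\<And>g h x y. x \<in> V g \<Longrightarrow> y \<in> V h \<Longrightarrow>
      prd (\<theta> x) (\<gamma> y) = prd (\<theta> x) (\<theta> y) \<and> prd (\<gamma> x) (\<theta> y) = prd (\<theta> x) (\<theta> y)"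
    and trade_brk: "\<And>g h x y. x \<in> V g \<Longrightarrow> y \<in> V h \<Longrightarrow>
      brk (\<theta> x) (\<gamma> y) = brk (\<theta> x) (\<theta> y) \<and> brk (\<gamma> x) (\<theta> y) = brk (\<theta> x) (\<theta> y)"
  shows "bihom_poisson_color_algebra scale V \<epsilon>
    (\<lambda>x y. prd (\<gamma> x) (\<theta> y)) (\<lambda>x y. brk (\<gamma> x) (\<theta> y)) (\<alpha> \<circ> \<gamma>) (\<beta> \<circ> \<gamma>)"
proof -
  have beta_alpha: "\<beta> (\<alpha> x) = \<alpha> (\<beta> x)" for x
    using alpha_beta_commute by (metis comp_apply)
  note mem = even_linear_mem[OF even(1)] even_linear_mem[OF even(2)]
    even_linear_mem[OF even_alpha] even_linear_mem[OF even_beta]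
  note commute = commute_\<gamma> commute_\<theta> beta_alpha
  note prd_prd = twisted_outer_right[where \<mu> = prd and \<nu> = prd and \<gamma> = \<gamma> and \<theta> = \<theta>,
      OF trade_prd conjunct2[OF trade_prd] even_prd even(2) mult_\<gamma>(1)]
  note brk_brk = twisted_outer_right[where \<mu> = brk and \<nu> = brk and \<gamma> = \<gamma> and \<theta> = \<theta>,
      OF trade_brk conjunct2[OF trade_brk] even_brk even(2) mult_\<gamma>(2)]
  note brk_prd = twisted_outer_right[where \<mu> = brk and \<nu> = prd and \<gamma> = \<gamma> and \<theta> = \<theta>,
      OF trade_brk conjunct2[OF trade_prd] even_prd even(2) mult_\<gamma>(1)]
  note prd_brk = twisted_outer_right[where \<mu> = prd and \<nu> = brk and \<gamma> = \<gamma> and \<theta> = \<theta>,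
      OF trade_prd conjunct2[OF trade_brk] even_brk even(2) mult_\<gamma>(2)]
  note left_prd = twisted_outer_left[where \<nu> = prd and \<gamma> = \<gamma> and \<theta> = \<theta>,
      OF conjunct2[OF trade_prd] mult_\<gamma>(1)]
  note left_brk = twisted_outer_left[where \<nu> = brk and \<gamma> = \<gamma> and \<theta> = \<theta>,
      OF conjunct2[OF trade_brk] mult_\<gamma>(2)]
  show ?thesis
  proof (unfold_locales, goal_cases)
    case 1
    show ?case by (rule even_bilinear_compose[OF even_prd even])
  next
    case 2
    show ?case by (rule even_bilinear_compose[OF even_brk even])
  next
    case 3
    show ?case by (rule even_linear_compose[OF even_alpha even(1)])
  next
    case 4
    show ?case by (rule even_linear_compose[OF even_beta even(1)])
  next
    case 5
    show ?case by (simp add: fun_eq_iff commute)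
  next
    case (6 x y)
    show ?case by (simp add: commute mult_\<gamma> alpha_prd)
  next
    case (7 x y)
    show ?case by (simp add: commute mult_\<gamma> beta_prd)
  next
    case (8 x y)
    show ?case by (simp add: commute mult_\<gamma> alpha_brk)
  next
    case (9 x y)
    show ?case by (simp add: commute mult_\<gamma> beta_brk)
  next
    case (10 x a y b z c)
    have r: "prd (\<gamma> (\<alpha> (\<gamma> x))) (\<theta> (prd (\<gamma> y) (\<theta> z)))
        = prd (\<theta> (\<alpha> (\<gamma> x))) (prd (\<gamma> (\<theta> y)) (\<gamma> (\<theta> z)))"
      using 10 by (intro prd_prd mem)
    have l: "prd (\<gamma> (prd (\<gamma> x) (\<theta> y))) (\<theta> (\<beta> (\<gamma> z)))
        = prd (prd (\<gamma> (\<theta> x)) (\<gamma> (\<theta> y))) (\<theta> (\<beta> (\<gamma> z)))"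
      using 10 by (intro left_prd)
    have "prd (\<alpha> (\<gamma> (\<theta> x))) (prd (\<gamma> (\<theta> y)) (\<gamma> (\<theta> z)))
        = prd (prd (\<gamma> (\<theta> x)) (\<gamma> (\<theta> y))) (\<beta> (\<gamma> (\<theta> z)))"
      using 10 by (intro bihom_associative mem)
    then show ?case by (simp only: comp_apply r l) (simp add: commute)
  next
    case (11 x a y b)
    have "brk (\<gamma> (\<beta> (\<gamma> u))) (\<theta> (\<alpha> (\<gamma> v))) = brk (\<theta> (\<beta> (\<gamma> u))) (\<theta> (\<alpha> (\<gamma> v)))"
      if "u \<in> V p" "v \<in> V q" for u v p q
      using that by (intro conjunct2[OF trade_brk] mem)
    note this[OF 11] this[OF 11(2,1)]
    moreover have "brk (\<beta> (\<gamma> (\<theta> x))) (\<alpha> (\<gamma> (\<theta> y)))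
        = - scale (\<epsilon> a b) (brk (\<beta> (\<gamma> (\<theta> y))) (\<alpha> (\<gamma> (\<theta> x))))"
      using 11 by (intro bihom_skew_symmetric mem)
    ultimately show ?case by (simp add: commute)
  next
    case (12 x a y b z c)
    \<comment> \<open>The outer element carries \<open>(\<beta>\<gamma>)\<^sup>2\<close>, and each inner one gains a second \<open>\<gamma>\<close> from the trade.\<close>
    have t: "brk (\<gamma> (\<beta> (\<gamma> (\<beta> (\<gamma> u))))) (\<theta> (brk (\<gamma> (\<beta> (\<gamma> v))) (\<theta> (\<alpha> (\<gamma> w)))))
        = brk (\<beta> (\<beta> (\<gamma> (\<gamma> (\<theta> u))))) (brk (\<beta> (\<gamma> (\<gamma> (\<theta> v)))) (\<alpha> (\<gamma> (\<gamma> (\<theta> w)))))"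
      if "u \<in> V p" "v \<in> V q" "w \<in> V r" for u v w p q r
    proof -
      have "brk (\<gamma> (\<beta> (\<gamma> (\<beta> (\<gamma> u))))) (\<theta> (brk (\<gamma> (\<beta> (\<gamma> v))) (\<theta> (\<alpha> (\<gamma> w)))))
          = brk (\<theta> (\<beta> (\<gamma> (\<beta> (\<gamma> u))))) (brk (\<gamma> (\<theta> (\<beta> (\<gamma> v)))) (\<gamma> (\<theta> (\<alpha> (\<gamma> w)))))"
        using that by (intro brk_brk mem)
      then show ?thesis by (simp add: commute)
    qed
    show ?case
      unfolding comp_apply t[OF 12] t[OF 12(2,3,1)] t[OF 12(3,1,2)]
      using 12 by (intro bihom_jacobi mem)
  next
    case (13 x a y b z c)
    have main: "brk (\<gamma> (\<alpha> (\<gamma> (\<beta> (\<gamma> x))))) (\<theta> (prd (\<gamma> y) (\<theta> z)))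
        = brk (\<theta> (\<alpha> (\<gamma> (\<beta> (\<gamma> x))))) (prd (\<gamma> (\<theta> y)) (\<gamma> (\<theta> z)))"
      using 13 by (intro brk_prd mem)
    have first: "prd (\<gamma> (brk (\<gamma> (\<beta> (\<gamma> x))) (\<theta> y))) (\<theta> (\<beta> (\<gamma> z)))
        = prd (brk (\<gamma> (\<theta> (\<beta> (\<gamma> x)))) (\<gamma> (\<theta> y))) (\<theta> (\<beta> (\<gamma> z)))"
      using 13 by (intro left_brk mem)
    have second: "prd (\<gamma> (\<beta> (\<gamma> y))) (\<theta> (brk (\<gamma> (\<alpha> (\<gamma> x))) (\<theta> z)))
        = prd (\<theta> (\<beta> (\<gamma> y))) (brk (\<gamma> (\<theta> (\<alpha> (\<gamma> x)))) (\<gamma> (\<theta> z)))"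
      using 13 by (intro prd_brk mem)
    have "brk (\<alpha> (\<beta> (\<gamma> (\<gamma> (\<theta> x))))) (prd (\<gamma> (\<theta> y)) (\<gamma> (\<theta> z)))
        = prd (brk (\<beta> (\<gamma> (\<gamma> (\<theta> x)))) (\<gamma> (\<theta> y))) (\<beta> (\<gamma> (\<theta> z)))
          + scale (\<epsilon> a b) (prd (\<beta> (\<gamma> (\<theta> y))) (brk (\<alpha> (\<gamma> (\<gamma> (\<theta> x)))) (\<gamma> (\<theta> z))))"
      using 13 by (intro bihom_leibniz mem)
    then show ?case by (simp only: comp_apply main first second) (simp add: commute)
  qed
qed

lemma funpow_commute:
  assumes "\<And>x. f (g x) = g (f x)"
  shows "(f ^^ n) (g x) = g ((f ^^ n) x)"
  by (induction n) (simp_all add: assms)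

lemma funpow_multiplicative:
  assumes "\<And>x y. f (\<mu> x y) = \<mu> (f x) (f y)"
  shows "(f ^^ n) (\<mu> x y) = \<mu> ((f ^^ n) x) ((f ^^ n) y)"
  by (induction n) (simp_all add: assms)

theorem theorem3p23:
  fixes scale :: "'k::field \<Rightarrow> 'p::ab_group_add \<Rightarrow> 'p"
    and V :: "'g::ab_group_add \<Rightarrow> 'p set"
    and \<epsilon> :: "'g \<Rightarrow> 'g \<Rightarrow> 'k"
    and prd brk :: "'p \<Rightarrow> 'p \<Rightarrow> 'p"
    and \<alpha> \<beta> \<theta> :: "'p \<Rightarrow> 'p"
    and k l :: nat
  assumes "CHAR('k) \<noteq> 2"
    and "bihom_poisson_color_algebra scale V \<epsilon> prd brk \<alpha> \<beta>"
    and "\<theta> \<in> bihom_poisson_color_algebra.centroid scale V prd brk \<alpha> \<beta> k l"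
  shows "bihom_poisson_color_algebra scale V \<epsilon>
    (\<lambda>x y. prd ((\<alpha> ^^ k) ((\<beta> ^^ l) x)) (\<theta> y))
    (\<lambda>x y. brk ((\<alpha> ^^ k) ((\<beta> ^^ l) x)) (\<theta> y))
    (\<alpha> ^^ (k + 1) \<circ> \<beta> ^^ l) (\<alpha> ^^ k \<circ> \<beta> ^^ (l + 1))"
proof -
  interpret bihom_poisson_color_algebra scale V \<epsilon> prd brk \<alpha> \<beta> by fact
  define \<gamma> where "\<gamma> = \<alpha> ^^ k \<circ> \<beta> ^^ l"
  have \<alpha>\<beta>: "\<alpha> (\<beta> x) = \<beta> (\<alpha> x)" for x
    using alpha_beta_commute by (metis comp_apply)
  have \<theta>\<alpha>: "\<alpha> (\<theta> x) = \<theta> (\<alpha> x)" and \<theta>\<beta>: "\<beta> (\<theta> x) = \<theta> (\<beta> x)" for x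
    using assms(3) by (simp_all add: centroid_def fun_eq_iff)
  have \<gamma>\<alpha>: "\<gamma> (\<alpha> x) = \<alpha> (\<gamma> x)" for x
    by (simp add: \<gamma>_def funpow_commute[of \<beta> \<alpha>, OF \<alpha>\<beta>[symmetric]] funpow_swap1)
  have \<gamma>\<beta>: "\<gamma> (\<beta> x) = \<beta> (\<gamma> x)" for x
    by (simp add: \<gamma>_def funpow_commute[of \<alpha> \<beta>, OF \<alpha>\<beta>] flip: funpow_swap1)
  have "bihom_poisson_color_algebra scale V \<epsilon>
    (\<lambda>x y. prd (\<gamma> x) (\<theta> y)) (\<lambda>x y. brk (\<gamma> x) (\<theta> y)) (\<alpha> \<circ> \<gamma>) (\<beta> \<circ> \<gamma>)"
  proof (rule centroid_twist)
    show "even_linear \<gamma>"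
      unfolding \<gamma>_def by (intro even_linear_compose even_linear_funpow even_alpha even_beta)
    show "even_linear \<theta>" using assms(3) by (simp add: centroid_def)
    show "\<theta> (\<gamma> x) = \<gamma> (\<theta> x)" for x
      by (simp add: \<gamma>_def funpow_commute[of \<alpha> \<theta>, OF \<theta>\<alpha>] funpow_commute[of \<beta> \<theta>, OF \<theta>\<beta>])
    show "\<gamma> (prd x y) = prd (\<gamma> x) (\<gamma> y)" for x y
      by (simp add: \<gamma>_def funpow_multiplicative[of _ prd] alpha_prd beta_prd)
    show "\<gamma> (brk x y) = brk (\<gamma> x) (\<gamma> y)" for x y
      by (simp add: \<gamma>_def funpow_multiplicative[of _ brk] alpha_brk beta_brk)
    show "prd (\<theta> x) (\<gamma> y) = prd (\<theta> x) (\<theta> y) \<and> prd (\<gamma> x) (\<theta> y) = prd (\<theta> x) (\<theta> y)"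
      if "x \<in> V g" "y \<in> V h" for g h x y
      using assms(3) that by (simp add: centroid_def \<gamma>_def)
    show "brk (\<theta> x) (\<gamma> y) = brk (\<theta> x) (\<theta> y) \<and> brk (\<gamma> x) (\<theta> y) = brk (\<theta> x) (\<theta> y)"
      if "x \<in> V g" "y \<in> V h" for g h x y
      using assms(3) that by (simp add: centroid_def \<gamma>_def)
  qed (simp_all add: \<gamma>\<alpha> \<gamma>\<beta> \<theta>\<alpha> \<theta>\<beta>)
  moreover have "\<alpha> ^^ (k + 1) \<circ> \<beta> ^^ l = \<alpha> \<circ> \<gamma>"
    by (simp add: \<gamma>_def o_assoc)
  moreover have "\<alpha> ^^ k \<circ> \<beta> ^^ (l + 1) = \<beta> \<circ> \<gamma>"
    by (simp add: \<gamma>_def fun_eq_iff funpow_commute[of \<alpha> \<beta>, OF \<alpha>\<beta>])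
  ultimately show ?thesis
    by (simp add: \<gamma>_def)
qed

end
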